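(* In any semi-cartesian category with dependence (SCCwD) $\mathcal C$, every $\Pi$-space in $\mathcal C$ is unique up to isomorphisms. More precisely, if $\Gamma\in\mathcal C$, $A\in\mathscr D_{\mathcal C}(\Gamma)$, $B\in\mathscr D_{\mathcal C}(\Gamma.A)$, and $\Pi(A,B),\Pi'(A,B)\in\mathscr D_{\mathcal C}(\Gamma)$ are both $\Pi$-spaces from $A$ to $B$ in $\mathcal C$, then $\Pi(A,B)\cong\Pi'(A,B)$ as D-objects.
   Context: A category with dependence (CwD) is a category $\mathcal C$ with: for each object $\Gamma$ a class $\mathscr D_{\mathcal C}(\Gamma)$ of D-objects over $\Gamma$; for each $\Gamma$, $A\in\mathscr D_{\mathcal C}(\Gamma)$ a class $\mathscr D_{\mathcal C}(\Gamma,A)$ of D-morphisms from $\Gamma$ to $A$; for each morphism $\phi:\Delta\to\Gamma$ functions $\_\{\phi\}:\mathscr D(\Gamma)\to\mathscr D(\Delta)$ and $\_\{\phi\}:\mathscr D(\Gamma,A)\to\mathscr D(\Delta,A\{\phi\})$ with $A\{\mathrm{id}\}=A$, $a\{\mathrm{id}\}=a$, $A\{\phi\circ\varphi\}=A\{\phi\}\{\varphi\}$, $a\{\phi\circ\varphi\}=a\{\phi\}\{\varphi\}$. A semi-$\Sigma$-space of $\Gamma$ and $A\in\mathscr D(\Gamma)$ is an object $\Gamma.A$ with $\pi_1:\Gamma.A\to\Gamma$ and $\pi_2\in\mathscr D(\Gamma.A,A\{\pi_1\})$ such that for all $\phi:\Delta\to\Gamma$ and $g\in\mathscr D(\Delta,A\{\phi\})$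 there is a unique $\langle\phi,g\rangle:\Delta\to\Gamma.A$ with $\pi_1\circ\langle\phi,g\rangle=\phi$ and $\pi_2\{\langle\phi,g\rangle\}=g$. An SCCwD is a CwD that has a terminal object and a semi-$\Sigma$-space of every $\Gamma$ and $A$. $\Gamma.A.B$ means $(\Gamma.A).B$. For $\phi:\Delta\to\Gamma$, $A\in\mathscr D(\Gamma)$ put $\phi^{+A}=\langle\phi\circ\pi_1,\pi_2\rangle:\Delta.A\{\phi\}\to\Gamma.A$; for $a\in\mathscr D(\Gamma,A)$ put $\overline a=\langle\mathrm{id}_\Gamma,a\rangle:\Gamma\to\Gamma.A$. The category $\mathcal C_{\mathscr D}$ of D-objects: objects are pairs $(\Gamma,C)$ with $C\in\mathscr D(\Gamma)$; morphisms $(\Delta,D)\to(\Gamma,C)$ are pairs $(\phi,f)$ with $\phi:\Delta\to\Gamma$, $f\in\mathscr D(\Delta.D,C\{\phi\circ\pi_1\})$; composition $(\psi,g)\circ(\phi,f)=(\psi\circ\phi,g\{\langle\phi\circ\pi_1,f\rangle\})$; identities $(\mathrm{id}_\Gamma,\pi_2)$. D-objects $A\in\mathscr D(\Gamma)$, $B\in\mathscr D(\Delta)$ are isomorphic, $A\cong B$, if $(\Gamma,A)\cong(\Delta,B)$ in $\mathcal C_{\mathscr D}$. A pseudo-$\Pi$-space from $A\in\mathscr D(\Gamma)$ to $B\in\mathscr D(\Gamma.A)$ is a D-object $\Pi(A,B)\in\mathscr D(\Gamma)$ with $\mathrm{dev}\in\mathscr D(\Gamma.\Pi(A,B).A\{\pi_1\},B\{\pi_1^{+A}\})$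 (here $\pi_1=\pi_1^{\Gamma.\Pi(A,B)}$) such that for each $f\in\mathscr D(\Gamma.A,B)$ there is a unique $\Lambda(f)\in\mathscr D(\Gamma,\Pi(A,B))$ with $\mathrm{dev}\{(\overline{\Lambda(f)})^{+A\{\pi_1\}}\}=f$. It is a $\Pi$-space iff for every $C\in\mathscr D(\Gamma)$, writing $p=\pi_1^{\Gamma.C}$, the D-object $\Pi(A,B)\{p\}\in\mathscr D(\Gamma.C)$ with $\mathrm{dev}\{(p^{+\Pi(A,B)})^{+A\{\pi_1\}}\}$ is a pseudo-$\Pi$-space from $A\{p\}$ to $B\{p^{+A}\}$ (with currying denoted $\Lambda_C$), and for any $D\in\mathscr D(\Gamma)$, $h\in\mathscr D(\Gamma.C.A\{p\},B\{p^{+A}\})$, $g\in\mathscr D(\Gamma.D,C\{\pi_1\})$: $$\mathrm{dev}\{\langle p,\Lambda_C(h)\rangle^{+A\{\pi_1\}}\}=h,\qquad \Lambda_D(h\{\langle\pi_1^{\Gamma.D},g\rangle^{+A\{p\}}\})=\Lambda_C(h)\{\langle\pi_1^{\Gamma.D},g\rangle\}.$$ *)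

theory Defs
  imports Main
begin

section \<open>Categories\<close>

record ('o, 'm) cat =
  Obj  :: "'o set"
  Arr  :: "'m set"
  Dom  :: "'m \<Rightarrow> 'o"
  Cod  :: "'m \<Rightarrow> 'o"
  Id   :: "'o \<Rightarrow> 'm"              ("\<one>\<index>")
  Comp :: "'m \<Rightarrow> 'm \<Rightarrow> 'm"       (infixr "\<cdot>\<index>" 75)

definition Hom :: "('o, 'm, 'z) cat_scheme \<Rightarrow> 'o \<Rightarrow> 'o \<Rightarrow> 'm set" where
  "Hom C X Y = {f \<in> Arr C. Dom C f = X \<and> Cod C f = Y}"

locale category =
  fixes C :: "('o, 'm, 'z) cat_scheme" (structure)
  assumes Dom_Obj: "f \<in> Arr C \<Longrightarrow> Dom C f \<in> Obj C"
    and Cod_Obj: "f \<in> Arr C \<Longrightarrow> Cod C f \<in> Obj C"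
    and Id_Hom: "X \<in> Obj C \<Longrightarrow> \<one> X \<in> Hom C X X"
    and Comp_Hom: "\<lbrakk>f \<in> Hom C X Y; g \<in> Hom C Y Z\<rbrakk> \<Longrightarrow> g \<cdot> f \<in> Hom C X Z"
    and Comp_Id: "f \<in> Hom C X Y \<Longrightarrow> f \<cdot> \<one> X = f"
    and Id_Comp: "f \<in> Hom C X Y \<Longrightarrow> \<one> Y \<cdot> f = f"
    and Comp_assoc: "\<lbrakk>f \<in> Hom C W X; g \<in> Hom C X Y; h \<in> Hom C Y Z\<rbrakk>
                      \<Longrightarrow> (h \<cdot> g) \<cdot> f = h \<cdot> (g \<cdot> f)"

definition isomorphic :: "('o, 'm, 'z) cat_scheme \<Rightarrow> 'o \<Rightarrow> 'o \<Rightarrow> bool" where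
  "isomorphic C X Y \<longleftrightarrow>
     (\<exists>f \<in> Hom C X Y. \<exists>g \<in> Hom C Y X. Comp C g f = Id C X \<and> Comp C f g = Id C Y)"

definition is_terminal :: "('o, 'm, 'z) cat_scheme \<Rightarrow> 'o \<Rightarrow> bool" where
  "is_terminal C T \<longleftrightarrow> T \<in> Obj C \<and> (\<forall>X \<in> Obj C. \<exists>!f. f \<in> Hom C X T)"


section \<open>Categories with dependence\<close>

text \<open>
  \<open>DObj C \<Gamma>\<close> and \<open>DMor C \<Gamma> A\<close> are the D-objects over \<open>\<Gamma>\<close> and the D-morphisms from \<open>\<Gamma>\<close>
  to \<open>A\<close>.  None of these classes are required to be disjoint for different indices.
  Therefore the action of an arrow on D-morphisms, written \<open>a\<lbrace>A; \<phi>\<rbrace>\<close>, also takes the D-object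
  \<open>A\<close> over the codomain of \<open>\<phi>\<close> such that \<open>a\<close> is a D-morphism to \<open>A\<close>.  The objects \<open>\<Gamma>\<close> and
  \<open>\<Delta>\<close> of \<open>\<phi> : \<Delta> \<rightarrow> \<Gamma>\<close> are determined by \<open>\<phi>\<close>.
\<close>

record ('o, 'm, 'd, 'e) cwd_struct = "('o, 'm) cat" +
  DObj :: "'o \<Rightarrow> 'd set"
  DMor :: "'o \<Rightarrow> 'd \<Rightarrow> 'e set"
  SubO :: "'d \<Rightarrow> 'm \<Rightarrow> 'd"           ("_\<lbrace>_\<rbrace>\<index>" [1000, 0] 1000)
  SubM :: "'e \<Rightarrow> 'd \<Rightarrow> 'm \<Rightarrow> 'e"     ("_\<lbrace>_; _\<rbrace>\<index>" [1000, 0, 0] 1000)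

locale cwd = category C
  for C :: "('o, 'm, 'd, 'e, 'z) cwd_struct_scheme" (structure) +
  assumes SubO_closed: "\<lbrakk>\<phi> \<in> Hom C \<Delta> \<Gamma>; A \<in> DObj C \<Gamma>\<rbrakk> \<Longrightarrow> A\<lbrace>\<phi>\<rbrace> \<in> DObj C \<Delta>"
    and SubM_closed: "\<lbrakk>\<phi> \<in> Hom C \<Delta> \<Gamma>; A \<in> DObj C \<Gamma>; a \<in> DMor C \<Gamma> A\<rbrakk>
                       \<Longrightarrow> a\<lbrace>A; \<phi>\<rbrace> \<in> DMor C \<Delta> (A\<lbrace>\<phi>\<rbrace>)"
    and SubO_Id: "\<lbrakk>\<Gamma> \<in> Obj C; A \<in> DObj C \<Gamma>\<rbrakk> \<Longrightarrow> A\<lbrace>\<one> \<Gamma>\<rbrace> = A"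
    and SubM_Id: "\<lbrakk>\<Gamma> \<in> Obj C; A \<in> DObj C \<Gamma>; a \<in> DMor C \<Gamma> A\<rbrakk> \<Longrightarrow> a\<lbrace>A; \<one> \<Gamma>\<rbrace> = a"
    and SubO_Comp: "\<lbrakk>\<psi> \<in> Hom C \<Theta> \<Delta>; \<phi> \<in> Hom C \<Delta> \<Gamma>; A \<in> DObj C \<Gamma>\<rbrakk>
                     \<Longrightarrow> A\<lbrace>\<phi> \<cdot> \<psi>\<rbrace> = A\<lbrace>\<phi>\<rbrace>\<lbrace>\<psi>\<rbrace>"
    and SubM_Comp: "\<lbrakk>\<psi> \<in> Hom C \<Theta> \<Delta>; \<phi> \<in> Hom C \<Delta> \<Gamma>; A \<in> DObj C \<Gamma>; a \<in> DMor C \<Gamma> A\<rbrakk>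
                     \<Longrightarrow> a\<lbrace>A; \<phi> \<cdot> \<psi>\<rbrace> = a\<lbrace>A; \<phi>\<rbrace>\<lbrace>A\<lbrace>\<phi>\<rbrace>; \<psi>\<rbrace>"


section \<open>Semi-cartesian categories with dependence\<close>

definition is_semi_sigma ::
  "('o, 'm, 'd, 'e, 'z) cwd_struct_scheme \<Rightarrow> 'o \<Rightarrow> 'd \<Rightarrow> 'o \<Rightarrow> 'm \<Rightarrow> 'e \<Rightarrow> bool" where
  "is_semi_sigma C \<Gamma> A S p1 p2 \<longleftrightarrow>
     S \<in> Obj C \<and> p1 \<in> Hom C S \<Gamma> \<and> p2 \<in> DMor C S (A\<lbrace>p1\<rbrace>\<^bsub>C\<^esub>) \<and>
     (\<forall>\<Delta> \<in> Obj C. \<forall>\<phi> \<in> Hom C \<Delta> \<Gamma>. \<forall>g \<in> DMor C \<Delta> (A\<lbrace>\<phi>\<rbrace>\<^bsub>C\<^esub>).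
        \<exists>!h. h \<in> Hom C \<Delta> S \<and> p1 \<cdot>\<^bsub>C\<^esub> h = \<phi> \<and> p2\<lbrace>A\<lbrace>p1\<rbrace>\<^bsub>C\<^esub>; h\<rbrace>\<^bsub>C\<^esub> = g)"

text \<open>
  A semi-\<open>\<Sigma>\<close>-space \<open>\<Gamma> \<triangleright> A\<close> (usually written \<open>\<Gamma>.A\<close>) with its projections is part of the
  data for every \<open>\<Gamma>\<close> and \<open>A\<close>; the choice is arbitrary.
\<close>

record ('o, 'm, 'd, 'e) sccwd_struct = "('o, 'm, 'd, 'e) cwd_struct" +
  Ext :: "'o \<Rightarrow> 'd \<Rightarrow> 'o"        (infixl "\<triangleright>\<index>" 70)
  Pr1 :: "'o \<Rightarrow> 'd \<Rightarrow> 'm"        ("\<pi>\<^sub>1\<index>")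
  Pr2 :: "'o \<Rightarrow> 'd \<Rightarrow> 'e"        ("\<pi>\<^sub>2\<index>")

locale sccwd = cwd C
  for C :: "('o, 'm, 'd, 'e, 'z) sccwd_struct_scheme" (structure) +
  assumes terminal: "\<exists>T. is_terminal C T"
    and semi_sigma: "\<lbrakk>\<Gamma> \<in> Obj C; A \<in> DObj C \<Gamma>\<rbrakk>
                      \<Longrightarrow> is_semi_sigma C \<Gamma> A (\<Gamma> \<triangleright> A) (\<pi>\<^sub>1 \<Gamma> A) (\<pi>\<^sub>2 \<Gamma> A)"


section \<open>The category of D-objects and \<open>\<Pi>\<close>-spaces\<close>

context
  fixes C :: "('o, 'm, 'd, 'e, 'z) sccwd_struct_scheme" (structure)
begin

text \<open>
  \<open>pair A \<phi> g\<close> is \<open>\<langle>\<phi>, g\<rangle> : \<Delta> \<rightarrow> \<Gamma>.A\<close>, where \<open>\<phi> : \<Delta> \<rightarrow> \<Gamma>\<close>; \<open>lift A \<phi>\<close> is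
  \<open>\<phi>\<^sup>+\<^sup>A : \<Delta>.A\<lbrace>\<phi>\<rbrace> \<rightarrow> \<Gamma>.A\<close>; and \<open>bar \<Gamma> A a\<close> is \<open>\<langle>\<one> \<Gamma>, a\<rangle> : \<Gamma> \<rightarrow> \<Gamma>.A\<close>.
\<close>

definition pair :: "'d \<Rightarrow> 'm \<Rightarrow> 'e \<Rightarrow> 'm" where
  "pair A \<phi> g =
     (let \<Delta> = Dom C \<phi>; \<Gamma> = Cod C \<phi> in
      THE h. h \<in> Hom C \<Delta> (\<Gamma> \<triangleright> A) \<and> \<pi>\<^sub>1 \<Gamma> A \<cdot> h = \<phi> \<and> (\<pi>\<^sub>2 \<Gamma> A)\<lbrace>A\<lbrace>\<pi>\<^sub>1 \<Gamma> A\<rbrace>; h\<rbrace> = g)"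

definition lift :: "'d \<Rightarrow> 'm \<Rightarrow> 'm" where
  "lift A \<phi> =
     (let \<Delta> = Dom C \<phi> in pair A (\<phi> \<cdot> \<pi>\<^sub>1 \<Delta> (A\<lbrace>\<phi>\<rbrace>)) (\<pi>\<^sub>2 \<Delta> (A\<lbrace>\<phi>\<rbrace>)))"

definition bar :: "'o \<Rightarrow> 'd \<Rightarrow> 'e \<Rightarrow> 'm" where
  "bar \<Gamma> A a = pair A (\<one> \<Gamma>) a"

text \<open>
  An arrow \<open>(\<phi>, f) : (\<Delta>, D) \<rightarrow> (\<Gamma>, E)\<close> of the category of D-objects is tagged with its domain
  and codomain.
\<close>

definition dobj_cat :: "('o \<times> 'd, ('o \<times> 'd) \<times> ('o \<times> 'd) \<times> 'm \<times> 'e) cat" where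
  "dobj_cat =
     \<lparr> Obj = {(\<Gamma>, E). \<Gamma> \<in> Obj C \<and> E \<in> DObj C \<Gamma>},
       Arr = {((\<Delta>, D), (\<Gamma>, E), \<phi>, f).
                \<Delta> \<in> Obj C \<and> D \<in> DObj C \<Delta> \<and> \<Gamma> \<in> Obj C \<and> E \<in> DObj C \<Gamma> \<and>
                \<phi> \<in> Hom C \<Delta> \<Gamma> \<and> f \<in> DMor C (\<Delta> \<triangleright> D) (E\<lbrace>\<phi> \<cdot> \<pi>\<^sub>1 \<Delta> D\<rbrace>)},
       Dom = (\<lambda>(X, Y, \<phi>, f). X),
       Cod = (\<lambda>(X, Y, \<phi>, f). Y),
       Id = (\<lambda>(\<Gamma>, E). ((\<Gamma>, E), (\<Gamma>, E), \<one> \<Gamma>, \<pi>\<^sub>2 \<Gamma> E)),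
       Comp = (\<lambda>((\<Gamma>, E), (\<Theta>, F), \<psi>, g) ((\<Delta>, D), _, \<phi>, f).
                ((\<Delta>, D), (\<Theta>, F), \<psi> \<cdot> \<phi>,
                 g\<lbrace>F\<lbrace>\<psi> \<cdot> \<pi>\<^sub>1 \<Gamma> E\<rbrace>; pair E (\<phi> \<cdot> \<pi>\<^sub>1 \<Delta> D) f\<rbrace>)) \<rparr>"

definition dobj_iso :: "'o \<Rightarrow> 'd \<Rightarrow> 'o \<Rightarrow> 'd \<Rightarrow> bool" where
  "dobj_iso \<Gamma> A \<Delta> B \<longleftrightarrow> isomorphic dobj_cat (\<Gamma>, A) (\<Delta>, B)"

text \<open>
  In the following, \<open>P\<close> is the candidate for \<open>\<Pi>(A, B)\<close>.  For an arrow \<open>k : \<Delta> \<rightarrow> \<Gamma>.P\<close>,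
  \<open>pi_app\<close> substitutes \<open>k\<^sup>+\<close>, the lift of \<open>k\<close> by \<open>A\<lbrace>\<pi>\<^sub>1 \<Gamma> P\<rbrace>\<close>, into \<open>dev\<close>.
\<close>

definition pi_app :: "'o \<Rightarrow> 'd \<Rightarrow> 'd \<Rightarrow> 'd \<Rightarrow> 'e \<Rightarrow> 'm \<Rightarrow> 'e" where
  "pi_app \<Gamma> A B P dev k =
     dev\<lbrace>B\<lbrace>lift A (\<pi>\<^sub>1 \<Gamma> P)\<rbrace>; lift (A\<lbrace>\<pi>\<^sub>1 \<Gamma> P\<rbrace>) k\<rbrace>"

definition is_pseudo_pi :: "'o \<Rightarrow> 'd \<Rightarrow> 'd \<Rightarrow> 'd \<Rightarrow> 'e \<Rightarrow> bool" where
  "is_pseudo_pi \<Gamma> A B P dev \<longleftrightarrow>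
     P \<in> DObj C \<Gamma> \<and>
     dev \<in> DMor C (\<Gamma> \<triangleright> P \<triangleright> A\<lbrace>\<pi>\<^sub>1 \<Gamma> P\<rbrace>) (B\<lbrace>lift A (\<pi>\<^sub>1 \<Gamma> P)\<rbrace>) \<and>
     (\<forall>f \<in> DMor C (\<Gamma> \<triangleright> A) B. \<exists>!l. l \<in> DMor C \<Gamma> P \<and> pi_app \<Gamma> A B P dev (bar \<Gamma> P l) = f)"

definition curry :: "'o \<Rightarrow> 'd \<Rightarrow> 'd \<Rightarrow> 'd \<Rightarrow> 'e \<Rightarrow> 'e \<Rightarrow> 'e" where
  "curry \<Gamma> A B P dev f = (THE l. l \<in> DMor C \<Gamma> P \<and> pi_app \<Gamma> A B P dev (bar \<Gamma> P l) = f)"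

text \<open>
  \<open>curry_over \<Gamma> A B P dev E\<close> is the currying \<open>\<Lambda>\<^sub>E\<close> of the pseudo-\<open>\<Pi>\<close>-space obtained by
  weakening \<open>P\<close> and \<open>dev\<close> along \<open>\<pi>\<^sub>1 : \<Gamma>.E \<rightarrow> \<Gamma>\<close>.
\<close>

definition dev_over :: "'o \<Rightarrow> 'd \<Rightarrow> 'd \<Rightarrow> 'd \<Rightarrow> 'e \<Rightarrow> 'd \<Rightarrow> 'e" where
  "dev_over \<Gamma> A B P dev E = pi_app \<Gamma> A B P dev (lift P (\<pi>\<^sub>1 \<Gamma> E))"

definition curry_over :: "'o \<Rightarrow> 'd \<Rightarrow> 'd \<Rightarrow> 'd \<Rightarrow> 'e \<Rightarrow> 'd \<Rightarrow> 'e \<Rightarrow> 'e" where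
  "curry_over \<Gamma> A B P dev E h =
     (let p = \<pi>\<^sub>1 \<Gamma> E in
      curry (\<Gamma> \<triangleright> E) (A\<lbrace>p\<rbrace>) (B\<lbrace>lift A p\<rbrace>) (P\<lbrace>p\<rbrace>) (dev_over \<Gamma> A B P dev E) h)"

definition is_pi :: "'o \<Rightarrow> 'd \<Rightarrow> 'd \<Rightarrow> 'd \<Rightarrow> 'e \<Rightarrow> bool" where
  "is_pi \<Gamma> A B P dev \<longleftrightarrow>
     is_pseudo_pi \<Gamma> A B P dev \<and>
     (\<forall>E \<in> DObj C \<Gamma>. let p = \<pi>\<^sub>1 \<Gamma> E in
        is_pseudo_pi (\<Gamma> \<triangleright> E) (A\<lbrace>p\<rbrace>) (B\<lbrace>lift A p\<rbrace>) (P\<lbrace>p\<rbrace>) (dev_over \<Gamma> A B P dev E) \<and>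
        (\<forall>D \<in> DObj C \<Gamma>. \<forall>h \<in> DMor C (\<Gamma> \<triangleright> E \<triangleright> A\<lbrace>p\<rbrace>) (B\<lbrace>lift A p\<rbrace>).
         \<forall>g \<in> DMor C (\<Gamma> \<triangleright> D) (E\<lbrace>\<pi>\<^sub>1 \<Gamma> D\<rbrace>).
           pi_app \<Gamma> A B P dev (pair P p (curry_over \<Gamma> A B P dev E h)) = h \<and>
           curry_over \<Gamma> A B P dev D
               (h\<lbrace>B\<lbrace>lift A p\<rbrace>; lift (A\<lbrace>p\<rbrace>) (pair E (\<pi>\<^sub>1 \<Gamma> D) g)\<rbrace>)
             = (curry_over \<Gamma> A B P dev E h)\<lbrace>P\<lbrace>p\<rbrace>; pair E (\<pi>\<^sub>1 \<Gamma> D) g\<rbrace>))"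

text \<open>A D-object \<open>P\<close> is a \<open>\<Pi>\<close>-space if it carries an evaluation making it one.\<close>

definition is_pi_space :: "'o \<Rightarrow> 'd \<Rightarrow> 'd \<Rightarrow> 'd \<Rightarrow> bool" where
  "is_pi_space \<Gamma> A B P \<longleftrightarrow> (\<exists>dev. is_pi \<Gamma> A B P dev)"

end

end

theory Submission
  imports Defs
begin

text \<open>
  A D-morphism into \<open>\<Pi>(A, B)\<lbrace>p\<rbrace>\<close> over \<open>\<Gamma>.E\<close>, with \<open>p\<close> the projection, is determined by its
  evaluation: currying over \<open>E\<close> inverts \<open>l \<mapsto> dev\<lbrace>\<langle>p, l\<rangle>\<^sup>+\<rbrace>\<close>.  In particular the second projection
  of \<open>\<Gamma>.\<Pi>(A, B)\<close> is the curried \<open>dev\<close>.  For two \<open>\<Pi>\<close>-spaces, the isomorphism and its inverse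
  curry the evaluation of one space with the currying of the other.  By naturality of currying,
  their composite is the curried \<open>dev\<close> of a single space, hence an identity.
\<close>

context category
begin

lemma HomD:
  assumes "f \<in> Hom C X Y"
  shows "Dom C f = X" "Cod C f = Y" "X \<in> Obj C" "Y \<in> Obj C"
  using assms Dom_Obj Cod_Obj by (auto simp: Hom_def)

end

context sccwd
begin

section \<open>Pairing, lifting and evaluation over an extended context\<close>

lemma
  assumes "\<Gamma> \<in> Obj C" "A \<in> DObj C \<Gamma>"
  shows Ext_Obj: "\<Gamma> \<triangleright> A \<in> Obj C"
    and Pr1_Hom: "\<pi>\<^sub>1 \<Gamma> A \<in> Hom C (\<Gamma> \<triangleright> A) \<Gamma>"
    and Pr2_DMor: "\<pi>\<^sub>2 \<Gamma> A \<in> DMor C (\<Gamma> \<triangleright> A) (A\<lbrace>\<pi>\<^sub>1 \<Gamma> A\<rbrace>)"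
  using semi_sigma[OF assms] by (auto simp: is_semi_sigma_def)

lemma pair_ex1:
  assumes \<phi>: "\<phi> \<in> Hom C \<Delta> \<Gamma>" and A: "A \<in> DObj C \<Gamma>" and g: "g \<in> DMor C \<Delta> (A\<lbrace>\<phi>\<rbrace>)"
  shows "\<exists>!h. h \<in> Hom C \<Delta> (\<Gamma> \<triangleright> A) \<and> \<pi>\<^sub>1 \<Gamma> A \<cdot> h = \<phi> \<and> (\<pi>\<^sub>2 \<Gamma> A)\<lbrace>A\<lbrace>\<pi>\<^sub>1 \<Gamma> A\<rbrace>; h\<rbrace> = g"
  using semi_sigma[OF HomD(4)[OF \<phi>] A] HomD(3)[OF \<phi>] \<phi> g
  unfolding is_semi_sigma_def by blast

lemma
  assumes \<phi>: "\<phi> \<in> Hom C \<Delta> \<Gamma>" and A: "A \<in> DObj C \<Gamma>" and g: "g \<in> DMor C \<Delta> (A\<lbrace>\<phi>\<rbrace>)"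
  shows pair_Hom: "pair C A \<phi> g \<in> Hom C \<Delta> (\<Gamma> \<triangleright> A)"
    and Pr1_pair: "\<pi>\<^sub>1 \<Gamma> A \<cdot> pair C A \<phi> g = \<phi>"
    and Pr2_pair: "(\<pi>\<^sub>2 \<Gamma> A)\<lbrace>A\<lbrace>\<pi>\<^sub>1 \<Gamma> A\<rbrace>; pair C A \<phi> g\<rbrace> = g"
  using theI'[OF pair_ex1[OF assms]] HomD[OF \<phi>] by (auto simp: pair_def)

text \<open>No typing of \<phi> and \<open>g\<close> is assumed: being computed from
  \<open>h\<close>, they have the right types automatically. An equation with a pairing thus reduces
  to computing two components.\<close>

lemma pair_unique:
  assumes h: "h \<in> Hom C \<Delta> (\<Gamma> \<triangleright> A)" and \<Gamma>: "\<Gamma> \<in> Obj C" and A: "A \<in> DObj C \<Gamma>"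
    and "\<pi>\<^sub>1 \<Gamma> A \<cdot> h = \<phi>" and "(\<pi>\<^sub>2 \<Gamma> A)\<lbrace>A\<lbrace>\<pi>\<^sub>1 \<Gamma> A\<rbrace>; h\<rbrace> = g"
  shows "pair C A \<phi> g = h"
proof -
  have \<phi>: "\<phi> \<in> Hom C \<Delta> \<Gamma>"
    using Comp_Hom[OF h Pr1_Hom[OF \<Gamma> A]] assms(4) by simp
  have "g \<in> DMor C \<Delta> (A\<lbrace>\<phi>\<rbrace>)"
    using SubM_closed[OF h SubO_closed[OF Pr1_Hom[OF \<Gamma> A] A] Pr2_DMor[OF \<Gamma> A]]
      SubO_Comp[OF h Pr1_Hom[OF \<Gamma> A] A] assms(4,5) by simp
  then show ?thesis
    using pair_ex1[OF \<phi> A] pair_Hom[OF \<phi> A] Pr1_pair[OF \<phi> A] Pr2_pair[OF \<phi> A] assms by blast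
qed

lemma pair_Pr: "pair C A (\<pi>\<^sub>1 \<Gamma> A) (\<pi>\<^sub>2 \<Gamma> A) = \<one> (\<Gamma> \<triangleright> A)"
  if "\<Gamma> \<in> Obj C" "A \<in> DObj C \<Gamma>"
proof (rule pair_unique[OF Id_Hom[OF Ext_Obj[OF that]] that])
  show "\<pi>\<^sub>1 \<Gamma> A \<cdot> \<one> (\<Gamma> \<triangleright> A) = \<pi>\<^sub>1 \<Gamma> A"
    by (rule Comp_Id[OF Pr1_Hom[OF that]])
  show "(\<pi>\<^sub>2 \<Gamma> A)\<lbrace>A\<lbrace>\<pi>\<^sub>1 \<Gamma> A\<rbrace>; \<one> (\<Gamma> \<triangleright> A)\<rbrace> = \<pi>\<^sub>2 \<Gamma> A"
    by (rule SubM_Id[OF Ext_Obj[OF that] SubO_closed[OF Pr1_Hom[OF that] that(2)] Pr2_DMor[OF that]])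
qed

lemma
  assumes \<phi>: "\<phi> \<in> Hom C \<Delta> \<Gamma>" and A: "A \<in> DObj C \<Gamma>"
  shows lift_Hom: "lift C A \<phi> \<in> Hom C (\<Delta> \<triangleright> A\<lbrace>\<phi>\<rbrace>) (\<Gamma> \<triangleright> A)"
    and Pr1_lift: "\<pi>\<^sub>1 \<Gamma> A \<cdot> lift C A \<phi> = \<phi> \<cdot> \<pi>\<^sub>1 \<Delta> (A\<lbrace>\<phi>\<rbrace>)"
    and Pr2_lift: "(\<pi>\<^sub>2 \<Gamma> A)\<lbrace>A\<lbrace>\<pi>\<^sub>1 \<Gamma> A\<rbrace>; lift C A \<phi>\<rbrace> = \<pi>\<^sub>2 \<Delta> (A\<lbrace>\<phi>\<rbrace>)"
proof -
  note \<Delta> = HomD(3)[OF \<phi>] and A\<phi> = SubO_closed[OF \<phi> A]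
  note p = Pr1_Hom[OF \<Delta> A\<phi>]
  have l: "lift C A \<phi> = pair C A (\<phi> \<cdot> \<pi>\<^sub>1 \<Delta> (A\<lbrace>\<phi>\<rbrace>)) (\<pi>\<^sub>2 \<Delta> (A\<lbrace>\<phi>\<rbrace>))"
    using HomD(1)[OF \<phi>] by (simp add: lift_def)
  have c: "\<phi> \<cdot> \<pi>\<^sub>1 \<Delta> (A\<lbrace>\<phi>\<rbrace>) \<in> Hom C (\<Delta> \<triangleright> A\<lbrace>\<phi>\<rbrace>) \<Gamma>"
    by (rule Comp_Hom[OF p \<phi>])
  \<comment> \<open>The second projection lies over an iterated substitution of \<open>A\<close>;
    functoriality turns it into the substitution along the composite, as the pairing
    demands.\<close>
  have g: "\<pi>\<^sub>2 \<Delta> (A\<lbrace>\<phi>\<rbrace>) \<in> DMor C (\<Delta> \<triangleright> A\<lbrace>\<phi>\<rbrace>) (A\<lbrace>\<phi> \<cdot> \<pi>\<^sub>1 \<Delta> (A\<lbrace>\<phi>\<rbrace>)\<rbrace>)"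
    using Pr2_DMor[OF \<Delta> A\<phi>] SubO_Comp[OF p \<phi> A] by simp
  show "lift C A \<phi> \<in> Hom C (\<Delta> \<triangleright> A\<lbrace>\<phi>\<rbrace>) (\<Gamma> \<triangleright> A)"
    and "\<pi>\<^sub>1 \<Gamma> A \<cdot> lift C A \<phi> = \<phi> \<cdot> \<pi>\<^sub>1 \<Delta> (A\<lbrace>\<phi>\<rbrace>)"
    and "(\<pi>\<^sub>2 \<Gamma> A)\<lbrace>A\<lbrace>\<pi>\<^sub>1 \<Gamma> A\<rbrace>; lift C A \<phi>\<rbrace> = \<pi>\<^sub>2 \<Delta> (A\<lbrace>\<phi>\<rbrace>)"
    unfolding l using pair_Hom[OF c A g] Pr1_pair[OF c A g] Pr2_pair[OF c A g] by auto
qed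

lemma lift_Id: "lift C A (\<one> \<Gamma>) = \<one> (\<Gamma> \<triangleright> A)" if "\<Gamma> \<in> Obj C" "A \<in> DObj C \<Gamma>"
  using pair_Pr[OF that] Id_Comp[OF Pr1_Hom[OF that]] SubO_Id[OF that] HomD(1)[OF Id_Hom[OF that(1)]]
  by (simp add: lift_def)

text \<open>Both sides have first component \<phi> \<cdot> \<psi> and second component
  \<open>a\<close>. Taking \<psi> to be an identity gives the composite of a lift with
  \<open>bar\<close>; taking it to be an arrow after a projection gives functoriality of
  lifting.\<close>

lemma lift_pair:
  assumes \<phi>: "\<phi> \<in> Hom C \<Delta> \<Gamma>" and A: "A \<in> DObj C \<Gamma>"
    and \<psi>: "\<psi> \<in> Hom C \<Theta> \<Delta>" and a: "a \<in> DMor C \<Theta> (A\<lbrace>\<phi>\<rbrace>\<lbrace>\<psi>\<rbrace>)"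
  shows "lift C A \<phi> \<cdot> pair C (A\<lbrace>\<phi>\<rbrace>) \<psi> a = pair C A (\<phi> \<cdot> \<psi>) a"
proof -
  note \<Gamma> = HomD(4)[OF \<phi>] and \<Delta> = HomD(3)[OF \<phi>] and A\<phi> = SubO_closed[OF \<phi> A]
  note q = Pr1_Hom[OF \<Gamma> A] and p = Pr1_Hom[OF \<Delta> A\<phi>]
  note l = lift_Hom[OF \<phi> A] and k = pair_Hom[OF \<psi> A\<phi> a]
  let ?k = "pair C (A\<lbrace>\<phi>\<rbrace>) \<psi> a"
  have "\<pi>\<^sub>1 \<Gamma> A \<cdot> (lift C A \<phi> \<cdot> ?k) = \<phi> \<cdot> (\<pi>\<^sub>1 \<Delta> (A\<lbrace>\<phi>\<rbrace>) \<cdot> ?k)"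
    using Comp_assoc[OF k l q] Comp_assoc[OF k p \<phi>] Pr1_lift[OF \<phi> A] by simp
  then have 1: "\<pi>\<^sub>1 \<Gamma> A \<cdot> (lift C A \<phi> \<cdot> ?k) = \<phi> \<cdot> \<psi>"
    using Pr1_pair[OF \<psi> A\<phi> a] by simp
  \<comment> \<open>\<open>SubM\<close> is indexed by the D-object of its argument. After the
    substitution along the composite is split in two, the index of the outer one has to be rewritten
    before \<open>Pr2_pair\<close> applies.\<close>
  have "A\<lbrace>\<pi>\<^sub>1 \<Gamma> A\<rbrace>\<lbrace>lift C A \<phi>\<rbrace> = A\<lbrace>\<phi>\<rbrace>\<lbrace>\<pi>\<^sub>1 \<Delta> (A\<lbrace>\<phi>\<rbrace>)\<rbrace>"
    using SubO_Comp[OF l q A] SubO_Comp[OF p \<phi> A] Pr1_lift[OF \<phi> A] by simp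
  then have "(\<pi>\<^sub>2 \<Gamma> A)\<lbrace>A\<lbrace>\<pi>\<^sub>1 \<Gamma> A\<rbrace>; lift C A \<phi> \<cdot> ?k\<rbrace> = a"
    using SubM_Comp[OF k l SubO_closed[OF q A] Pr2_DMor[OF \<Gamma> A]] Pr2_lift[OF \<phi> A]
      Pr2_pair[OF \<psi> A\<phi> a] by simp
  with 1 show ?thesis
    using pair_unique[OF Comp_Hom[OF k l] \<Gamma> A] by simp
qed

text \<open>The inner lift is itself a pairing, so this is \<open>lift_pair\<close> with first
  component \<open>\<psi> \<cdot> \<pi>\<^sub>1\<close> and second component
  \<open>\<pi>\<^sub>2\<close>.\<close>

lemma lift_Comp:
  assumes \<phi>: "\<phi> \<in> Hom C \<Delta> \<Gamma>" and A: "A \<in> DObj C \<Gamma>" and \<psi>: "\<psi> \<in> Hom C \<Theta> \<Delta>"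
  shows "lift C A \<phi> \<cdot> lift C (A\<lbrace>\<phi>\<rbrace>) \<psi> = lift C A (\<phi> \<cdot> \<psi>)"
proof -
  note \<Theta> = HomD(3)[OF \<psi>] and A\<phi> = SubO_closed[OF \<phi> A]
  note A\<psi> = SubO_closed[OF \<psi> A\<phi>]
  note p = Pr1_Hom[OF \<Theta> A\<psi>] and AC = SubO_Comp[OF \<psi> \<phi> A]
  have "\<pi>\<^sub>2 \<Theta> (A\<lbrace>\<phi>\<rbrace>\<lbrace>\<psi>\<rbrace>) \<in> DMor C (\<Theta> \<triangleright> A\<lbrace>\<phi>\<rbrace>\<lbrace>\<psi>\<rbrace>) (A\<lbrace>\<phi>\<rbrace>\<lbrace>\<psi> \<cdot> \<pi>\<^sub>1 \<Theta> (A\<lbrace>\<phi>\<rbrace>\<lbrace>\<psi>\<rbrace>)\<rbrace>)"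
    using Pr2_DMor[OF \<Theta> A\<psi>] SubO_Comp[OF p \<psi> A\<phi>] by simp
  from lift_pair[OF \<phi> A Comp_Hom[OF p \<psi>] this] show ?thesis
    using HomD(1)[OF \<psi>] HomD(1)[OF Comp_Hom[OF \<psi> \<phi>]] Comp_assoc[OF p \<psi> \<phi>] AC
    by (simp add: lift_def)
qed

text \<open>The lift of \<open>p\<close> by \<open>P\<close> takes \<open>bar\<close> of
  \<open>l\<close> to the pairing of \<open>p\<close> and \<open>l\<close>, and lifting by
  \<open>A\<close> preserves this composite. The universal property over
  \<open>\<Gamma> \<triangleright> E\<close> thereby becomes a statement about the original
  \<open>dev\<close>.\<close>

lemma pi_app_dev_over:
  assumes \<Gamma>: "\<Gamma> \<in> Obj C" and A: "A \<in> DObj C \<Gamma>" and B: "B \<in> DObj C (\<Gamma> \<triangleright> A)"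
    and P: "P \<in> DObj C \<Gamma>" and E: "E \<in> DObj C \<Gamma>"
    and dev: "dev \<in> DMor C (\<Gamma> \<triangleright> P \<triangleright> A\<lbrace>\<pi>\<^sub>1 \<Gamma> P\<rbrace>) (B\<lbrace>lift C A (\<pi>\<^sub>1 \<Gamma> P)\<rbrace>)"
    and l: "l \<in> DMor C (\<Gamma> \<triangleright> E) (P\<lbrace>\<pi>\<^sub>1 \<Gamma> E\<rbrace>)"
  defines "p \<equiv> \<pi>\<^sub>1 \<Gamma> E"
  shows "pi_app C (\<Gamma> \<triangleright> E) (A\<lbrace>p\<rbrace>) (B\<lbrace>lift C A p\<rbrace>) (P\<lbrace>p\<rbrace>) (dev_over C \<Gamma> A B P dev E)
           (bar C (\<Gamma> \<triangleright> E) (P\<lbrace>p\<rbrace>) l) = pi_app C \<Gamma> A B P dev (pair C P p l)"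
proof -
  define r where "r = \<pi>\<^sub>1 \<Gamma> P"
  define q where "q = \<pi>\<^sub>1 (\<Gamma> \<triangleright> E) (P\<lbrace>p\<rbrace>)"
  let ?b = "bar C (\<Gamma> \<triangleright> E) (P\<lbrace>p\<rbrace>) l"
  note GE = Ext_Obj[OF \<Gamma> E]
  have p: "p \<in> Hom C (\<Gamma> \<triangleright> E) \<Gamma>" unfolding p_def by (rule Pr1_Hom[OF \<Gamma> E])
  note Pp = SubO_closed[OF p P] and Ap = SubO_closed[OF p A]
  have r: "r \<in> Hom C (\<Gamma> \<triangleright> P) \<Gamma>" unfolding r_def by (rule Pr1_Hom[OF \<Gamma> P])
  have q: "q \<in> Hom C (\<Gamma> \<triangleright> E \<triangleright> P\<lbrace>p\<rbrace>) (\<Gamma> \<triangleright> E)" unfolding q_def by (rule Pr1_Hom[OF GE Pp])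
  note Ar = SubO_closed[OF r A] and Br = SubO_closed[OF lift_Hom[OF r A] B]
  note lP = lift_Hom[OF p P]
  note L = lift_Hom[OF lP Ar]
  have l': "l \<in> DMor C (\<Gamma> \<triangleright> E) (P\<lbrace>p\<rbrace>\<lbrace>\<one> (\<Gamma> \<triangleright> E)\<rbrace>)"
    using l SubO_Id[OF GE Pp] by (simp add: p_def)
  have b: "?b \<in> Hom C (\<Gamma> \<triangleright> E) (\<Gamma> \<triangleright> E \<triangleright> P\<lbrace>p\<rbrace>)"
    unfolding bar_def by (rule pair_Hom[OF Id_Hom[OF GE] Pp l'])
  have lb: "lift C P p \<cdot> ?b = pair C P p l"
    unfolding bar_def lift_pair[OF p P Id_Hom[OF GE] l'] by (simp add: Comp_Id[OF p])
  \<comment> \<open>\<open>dev_over\<close> is typed along one side of this commuting square, while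
    evaluation over \<open>\<Gamma> \<triangleright> E\<close> is indexed along the other.
    Substituting into \<open>A\<close>, and into \<open>B\<close> along the lifted square,
    identifies the two indices in \<open>Aeq\<close> and \<open>Beq\<close>.\<close>
  have eq: "r \<cdot> lift C P p = p \<cdot> q"
    unfolding r_def q_def by (rule Pr1_lift[OF p P])
  have Aeq: "A\<lbrace>r\<rbrace>\<lbrace>lift C P p\<rbrace> = A\<lbrace>p\<rbrace>\<lbrace>q\<rbrace>"
    using SubO_Comp[OF lP r A] SubO_Comp[OF q p A] eq by simp
  have "lift C A r \<cdot> lift C (A\<lbrace>r\<rbrace>) (lift C P p) = lift C A p \<cdot> lift C (A\<lbrace>p\<rbrace>) q"
    using lift_Comp[OF r A lP] lift_Comp[OF p A q] eq by simp
  then have Beq: "B\<lbrace>lift C A r\<rbrace>\<lbrace>lift C (A\<lbrace>r\<rbrace>) (lift C P p)\<rbrace> = B\<lbrace>lift C A p\<rbrace>\<lbrace>lift C (A\<lbrace>p\<rbrace>) q\<rbrace>"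
    using SubO_Comp[OF L lift_Hom[OF r A] B] SubO_Comp[OF lift_Hom[OF q Ap] lift_Hom[OF p A] B]
    by simp
  have dev': "dev \<in> DMor C (\<Gamma> \<triangleright> P \<triangleright> A\<lbrace>r\<rbrace>) (B\<lbrace>lift C A r\<rbrace>)"
    using dev by (simp add: r_def)
  \<comment> \<open>The lifted pairing is factored so that its first substitution yields
    \<open>dev_over\<close> and its second is the evaluation at \<open>?b\<close>.\<close>
  have "dev\<lbrace>B\<lbrace>lift C A r\<rbrace>; lift C (A\<lbrace>r\<rbrace>) (pair C P p l)\<rbrace>
    = dev\<lbrace>B\<lbrace>lift C A r\<rbrace>; lift C (A\<lbrace>r\<rbrace>) (lift C P p) \<cdot> lift C (A\<lbrace>r\<rbrace>\<lbrace>lift C P p\<rbrace>) ?b\<rbrace>"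
    using lift_Comp[OF lP Ar b] lb by simp
  also have "\<dots> = dev\<lbrace>B\<lbrace>lift C A r\<rbrace>; lift C (A\<lbrace>r\<rbrace>) (lift C P p)\<rbrace>
      \<lbrace>B\<lbrace>lift C A r\<rbrace>\<lbrace>lift C (A\<lbrace>r\<rbrace>) (lift C P p)\<rbrace>; lift C (A\<lbrace>r\<rbrace>\<lbrace>lift C P p\<rbrace>) ?b\<rbrace>"
    by (rule SubM_Comp[OF lift_Hom[OF b SubO_closed[OF lP Ar]] L Br dev'])
  finally show ?thesis
    unfolding Beq Aeq by (simp add: pi_app_def dev_over_def p_def[symmetric] r_def[symmetric] q_def[symmetric])
qed

section \<open>Currying in \<Pi>-spaces and the resulting isomorphism\<close>

lemma is_piD:
  assumes "is_pi C \<Gamma> A B P dev"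
  shows "P \<in> DObj C \<Gamma>"
    and "dev \<in> DMor C (\<Gamma> \<triangleright> P \<triangleright> A\<lbrace>\<pi>\<^sub>1 \<Gamma> P\<rbrace>) (B\<lbrace>lift C A (\<pi>\<^sub>1 \<Gamma> P)\<rbrace>)"
    and "E \<in> DObj C \<Gamma> \<Longrightarrow> is_pseudo_pi C (\<Gamma> \<triangleright> E) (A\<lbrace>\<pi>\<^sub>1 \<Gamma> E\<rbrace>) (B\<lbrace>lift C A (\<pi>\<^sub>1 \<Gamma> E)\<rbrace>)
           (P\<lbrace>\<pi>\<^sub>1 \<Gamma> E\<rbrace>) (dev_over C \<Gamma> A B P dev E)"
    and "\<lbrakk>E \<in> DObj C \<Gamma>; D \<in> DObj C \<Gamma>;
          h \<in> DMor C (\<Gamma> \<triangleright> E \<triangleright> A\<lbrace>\<pi>\<^sub>1 \<Gamma> E\<rbrace>) (B\<lbrace>lift C A (\<pi>\<^sub>1 \<Gamma> E)\<rbrace>);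
          g \<in> DMor C (\<Gamma> \<triangleright> D) (E\<lbrace>\<pi>\<^sub>1 \<Gamma> D\<rbrace>)\<rbrakk>
         \<Longrightarrow> curry_over C \<Gamma> A B P dev D
               (h\<lbrace>B\<lbrace>lift C A (\<pi>\<^sub>1 \<Gamma> E)\<rbrace>; lift C (A\<lbrace>\<pi>\<^sub>1 \<Gamma> E\<rbrace>) (pair C E (\<pi>\<^sub>1 \<Gamma> D) g)\<rbrace>)
             = (curry_over C \<Gamma> A B P dev E h)\<lbrace>P\<lbrace>\<pi>\<^sub>1 \<Gamma> E\<rbrace>; pair C E (\<pi>\<^sub>1 \<Gamma> D) g\<rbrace>"
  \<comment> \<open>Instantiating the definition at \<Gamma> keeps the pseudo-\<Pi>-spaces over
    \<open>\<Gamma> \<triangleright> E\<close> folded, as the third claim requires.\<close>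
  using assms unfolding is_pi_def Let_def is_pseudo_pi_def[of C \<Gamma>] by blast+

lemma curry_over_ex1:
  assumes "is_pi C \<Gamma> A B P dev" and "E \<in> DObj C \<Gamma>"
    and "h \<in> DMor C (\<Gamma> \<triangleright> E \<triangleright> A\<lbrace>\<pi>\<^sub>1 \<Gamma> E\<rbrace>) (B\<lbrace>lift C A (\<pi>\<^sub>1 \<Gamma> E)\<rbrace>)"
  shows "\<exists>!l. l \<in> DMor C (\<Gamma> \<triangleright> E) (P\<lbrace>\<pi>\<^sub>1 \<Gamma> E\<rbrace>) \<and>
           pi_app C (\<Gamma> \<triangleright> E) (A\<lbrace>\<pi>\<^sub>1 \<Gamma> E\<rbrace>) (B\<lbrace>lift C A (\<pi>\<^sub>1 \<Gamma> E)\<rbrace>) (P\<lbrace>\<pi>\<^sub>1 \<Gamma> E\<rbrace>)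
             (dev_over C \<Gamma> A B P dev E) (bar C (\<Gamma> \<triangleright> E) (P\<lbrace>\<pi>\<^sub>1 \<Gamma> E\<rbrace>) l) = h"
  using is_piD(3)[OF assms(1,2)] assms(3) unfolding is_pseudo_pi_def by blast

text \<open>This is unique existence in the weakened pseudo-\<Pi>-space, with its evaluation at
  \<open>bar\<close> replaced by that of the original \<open>dev\<close> at a pairing through
  \<open>pi_app_dev_over\<close>.\<close>

lemma
  assumes \<Gamma>: "\<Gamma> \<in> Obj C" and A: "A \<in> DObj C \<Gamma>" and B: "B \<in> DObj C (\<Gamma> \<triangleright> A)"
    and pi: "is_pi C \<Gamma> A B P dev" and E: "E \<in> DObj C \<Gamma>"
    and h: "h \<in> DMor C (\<Gamma> \<triangleright> E \<triangleright> A\<lbrace>\<pi>\<^sub>1 \<Gamma> E\<rbrace>) (B\<lbrace>lift C A (\<pi>\<^sub>1 \<Gamma> E)\<rbrace>)"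
  shows curry_over_DMor: "curry_over C \<Gamma> A B P dev E h \<in> DMor C (\<Gamma> \<triangleright> E) (P\<lbrace>\<pi>\<^sub>1 \<Gamma> E\<rbrace>)"
    and pi_app_curry_over: "pi_app C \<Gamma> A B P dev (pair C P (\<pi>\<^sub>1 \<Gamma> E) (curry_over C \<Gamma> A B P dev E h)) = h"
    and curry_over_eqI: "\<lbrakk>l \<in> DMor C (\<Gamma> \<triangleright> E) (P\<lbrace>\<pi>\<^sub>1 \<Gamma> E\<rbrace>); pi_app C \<Gamma> A B P dev (pair C P (\<pi>\<^sub>1 \<Gamma> E) l) = h\<rbrakk>
           \<Longrightarrow> curry_over C \<Gamma> A B P dev E h = l"
proof -
  note eval = pi_app_dev_over[OF \<Gamma> A B is_piD(1)[OF pi] E is_piD(2)[OF pi]]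
  note ex1 = curry_over_ex1[OF pi E h]
  have c: "curry_over C \<Gamma> A B P dev E h \<in> DMor C (\<Gamma> \<triangleright> E) (P\<lbrace>\<pi>\<^sub>1 \<Gamma> E\<rbrace>) \<and>
    pi_app C (\<Gamma> \<triangleright> E) (A\<lbrace>\<pi>\<^sub>1 \<Gamma> E\<rbrace>) (B\<lbrace>lift C A (\<pi>\<^sub>1 \<Gamma> E)\<rbrace>) (P\<lbrace>\<pi>\<^sub>1 \<Gamma> E\<rbrace>) (dev_over C \<Gamma> A B P dev E)
      (bar C (\<Gamma> \<triangleright> E) (P\<lbrace>\<pi>\<^sub>1 \<Gamma> E\<rbrace>) (curry_over C \<Gamma> A B P dev E h)) = h"
    unfolding curry_over_def Let_def curry_def by (rule theI'[OF ex1])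
  then show "curry_over C \<Gamma> A B P dev E h \<in> DMor C (\<Gamma> \<triangleright> E) (P\<lbrace>\<pi>\<^sub>1 \<Gamma> E\<rbrace>)"
    and "pi_app C \<Gamma> A B P dev (pair C P (\<pi>\<^sub>1 \<Gamma> E) (curry_over C \<Gamma> A B P dev E h)) = h"
    using eval by auto
  show "curry_over C \<Gamma> A B P dev E h = l"
    if "l \<in> DMor C (\<Gamma> \<triangleright> E) (P\<lbrace>\<pi>\<^sub>1 \<Gamma> E\<rbrace>)" "pi_app C \<Gamma> A B P dev (pair C P (\<pi>\<^sub>1 \<Gamma> E) l) = h"
    unfolding curry_over_def Let_def curry_def
    by (rule the1_equality[OF ex1]) (simp add: eval that)
qed

text \<open>With \<open>E\<close> equal to \<open>P\<close>, \<open>dev\<close> itself has the type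
  of a D-morphism to be curried. The pairing of the two projections is an identity, so evaluating at
  \<open>\<pi>\<^sub>2\<close> gives back \<open>dev\<close>, and uniqueness of currying
  applies.\<close>

lemma curry_over_dev:
  assumes \<Gamma>: "\<Gamma> \<in> Obj C" and A: "A \<in> DObj C \<Gamma>" and B: "B \<in> DObj C (\<Gamma> \<triangleright> A)"
    and pi: "is_pi C \<Gamma> A B P dev"
  shows "curry_over C \<Gamma> A B P dev P dev = \<pi>\<^sub>2 \<Gamma> P"
proof (rule curry_over_eqI[OF \<Gamma> A B pi is_piD(1,2)[OF pi]])
  note P = is_piD(1)[OF pi]
  note Ap = SubO_closed[OF Pr1_Hom[OF \<Gamma> P] A]
  show "\<pi>\<^sub>2 \<Gamma> P \<in> DMor C (\<Gamma> \<triangleright> P) (P\<lbrace>\<pi>\<^sub>1 \<Gamma> P\<rbrace>)"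
    by (rule Pr2_DMor[OF \<Gamma> P])
  show "pi_app C \<Gamma> A B P dev (pair C P (\<pi>\<^sub>1 \<Gamma> P) (\<pi>\<^sub>2 \<Gamma> P)) = dev"
    unfolding pi_app_def pair_Pr[OF \<Gamma> P] lift_Id[OF Ext_Obj[OF \<Gamma> P] Ap]
    by (rule SubM_Id[OF Ext_Obj[OF Ext_Obj[OF \<Gamma> P] Ap]
          SubO_closed[OF lift_Hom[OF Pr1_Hom[OF \<Gamma> P] A] B] is_piD(2)[OF pi]])
qed

text \<open>Naturality, with \<open>E\<close> as \<open>P'\<close>, \<open>D\<close> as
  \<open>P\<close> and \<open>h\<close> as \<open>dev'\<close>, moves the substitution inside the
  currying of \<open>dev'\<close>. There the evaluation law of \<open>P'\<close> turns the
  substituted \<open>dev'\<close> into \<open>dev\<close>, whose currying is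
  \<open>\<pi>\<^sub>2\<close> by \<open>curry_over_dev\<close>.\<close>

lemma curry_over_comp:
  assumes \<Gamma>: "\<Gamma> \<in> Obj C" and A: "A \<in> DObj C \<Gamma>" and B: "B \<in> DObj C (\<Gamma> \<triangleright> A)"
    and pi: "is_pi C \<Gamma> A B P dev" and pi': "is_pi C \<Gamma> A B P' dev'"
  shows "(curry_over C \<Gamma> A B P dev P' dev')
           \<lbrace>P\<lbrace>\<pi>\<^sub>1 \<Gamma> P'\<rbrace>; pair C P' (\<pi>\<^sub>1 \<Gamma> P) (curry_over C \<Gamma> A B P' dev' P dev)\<rbrace> = \<pi>\<^sub>2 \<Gamma> P"
proof -
  note P = is_piD(1,2)[OF pi] and P' = is_piD(1,2)[OF pi']
  show ?thesis
    using is_piD(4)[OF pi P'(1) P(1) P'(2) curry_over_DMor[OF \<Gamma> A B pi' P]]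
      pi_app_curry_over[OF \<Gamma> A B pi' P] curry_over_dev[OF \<Gamma> A B pi]
    by (simp add: pi_app_def)
qed

text \<open>Over identity arrows of \<Gamma>, composing D-object arrows amounts to the substitutions
  in \<open>vu\<close> and \<open>uv\<close>, and identities have \<open>\<pi>\<^sub>2\<close> as
  D-morphism component. The two equations are therefore the two inverse laws.\<close>

lemma dobj_isoI:
  assumes \<Gamma>: "\<Gamma> \<in> Obj C" and P: "P \<in> DObj C \<Gamma>" and P': "P' \<in> DObj C \<Gamma>"
    and u: "u \<in> DMor C (\<Gamma> \<triangleright> P) (P'\<lbrace>\<pi>\<^sub>1 \<Gamma> P\<rbrace>)" and v: "v \<in> DMor C (\<Gamma> \<triangleright> P') (P\<lbrace>\<pi>\<^sub>1 \<Gamma> P'\<rbrace>)"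
    and vu: "v\<lbrace>P\<lbrace>\<pi>\<^sub>1 \<Gamma> P'\<rbrace>; pair C P' (\<pi>\<^sub>1 \<Gamma> P) u\<rbrace> = \<pi>\<^sub>2 \<Gamma> P"
    and uv: "u\<lbrace>P'\<lbrace>\<pi>\<^sub>1 \<Gamma> P\<rbrace>; pair C P (\<pi>\<^sub>1 \<Gamma> P') v\<rbrace> = \<pi>\<^sub>2 \<Gamma> P'"
  shows "dobj_iso C \<Gamma> P \<Gamma> P'"
proof -
  let ?f = "((\<Gamma>, P), (\<Gamma>, P'), \<one> \<Gamma>, u)" and ?g = "((\<Gamma>, P'), (\<Gamma>, P), \<one> \<Gamma>, v)"
  \<comment> \<open>These absorb the identity arrow in the types of \<open>u\<close> and
    \<open>v\<close>, in the pairings of the composition and in the base component.\<close>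
  note simps = Id_Comp[OF Pr1_Hom[OF \<Gamma> P]] Id_Comp[OF Pr1_Hom[OF \<Gamma> P']] Id_Comp[OF Id_Hom[OF \<Gamma>]]
  have "?f \<in> Hom (dobj_cat C) (\<Gamma>, P) (\<Gamma>, P')" "?g \<in> Hom (dobj_cat C) (\<Gamma>, P') (\<Gamma>, P)"
    unfolding Hom_def[of "dobj_cat C"] using assms(1-5) Id_Hom[OF \<Gamma>]
    by (simp_all add: dobj_cat_def simps)
  moreover have "Comp (dobj_cat C) ?g ?f = Id (dobj_cat C) (\<Gamma>, P)"
    and "Comp (dobj_cat C) ?f ?g = Id (dobj_cat C) (\<Gamma>, P')"
    using vu uv by (simp_all add: dobj_cat_def simps)
  ultimately show ?thesis
    unfolding dobj_iso_def isomorphic_def by blast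
qed

end

theorem proposition3p4p8:
  fixes C :: "('o, 'm, 'd, 'e, 'z) sccwd_struct_scheme"
    and \<Gamma> :: 'o and A B P P' :: 'd
  assumes "sccwd C"
    and "\<Gamma> \<in> Obj C"
    and "A \<in> DObj C \<Gamma>"
    and "B \<in> DObj C (Ext C \<Gamma> A)"
    and "is_pi_space C \<Gamma> A B P"
    and "is_pi_space C \<Gamma> A B P'"
  shows "dobj_iso C \<Gamma> P \<Gamma> P'"
proof -
  interpret sccwd C by fact
  obtain dev dev' where pi: "is_pi C \<Gamma> A B P dev" and pi': "is_pi C \<Gamma> A B P' dev'"
    using assms(5,6) unfolding is_pi_space_def by blast
  \<comment> \<open>Each fact list supplies a D-object to extend by together with its evaluation as
    the D-morphism to curry. Exchanging the two spaces turns one composite law into the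
    other.\<close>
  note P = is_piD(1,2)[OF pi] and P' = is_piD(1,2)[OF pi']
  show ?thesis
    by (rule dobj_isoI[OF assms(2) P(1) P'(1) curry_over_DMor[OF assms(2-4) pi' P]
          curry_over_DMor[OF assms(2-4) pi P'] curry_over_comp[OF assms(2-4) pi pi']
          curry_over_comp[OF assms(2-4) pi' pi]])
qed

end
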